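(* Suppose that $S:U\to Y$ satisfies the two assumptions stated in the context (weak-to-weak continuity and twice Fréchet differentiability). Then for every $\alpha>0$ and every $\beta\ge 0$ there exists a solution $\bar u\in U$ to the problem $$\min_{u\in U}\ \tfrac12\|S(u)-z\|_Y^2+\mathcal{G}(u),\qquad \mathcal{G}=\mathcal{G}_0^{**}.$$
   Context: $\Omega\subset\mathbb{R}^N$ is a bounded domain, $d\ge 2$, and $u_1<u_2<\dots<u_d$ are given real numbers. The admissible set is $U=\{u\in L^2(\Omega): u(x)\in[u_1,u_d]\text{ for almost all }x\in\Omega\}$. $Y$ is a Hilbert space, $z\in Y$ is given, and $S:U\to Y$ is a (generally nonlinear) mapping. Assumptions on $S$: (i) $S$ is weak-to-weak continuous, i.e. if $\{u_n\}_{n\in\mathbb{N}}\subset U$ and $u_n\rightharpoonup u\in U$ weakly in $L^2(\Omega)$, then $S(u_n)\rightharpoonup S(u)$ weakly in $Y$; (ii) $S$ is twice Fréchet differentiable on $U$. For $\alpha>0$, $\beta\ge0$ define $\mathcal{G}_0:L^2(\Omega)\to\mathbb{R}\cup\{+\infty\}$ by $$\mathcal{G}_0(u)=\tfrac\alpha2\|u\|_{L^2(\Omega)}^2+\beta\int_\Omega\prod_{i=1}^d|u(x)-u_i|^0\,dx+\delta_U(u),$$ where $|0|^0=0$, $|t|^0=1$ for $t\ne0$, and $\delta_U(u)=0$ if $u\in U$, $\delta_U(u)=+\infty$ otherwise. $\mathcal{G}_0^*(q)=\sup_{u\in L^2(\Omega)}\langle q,u\rangle-\mathcal{G}_0(u)$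 is the Fenchel conjugate on $L^2(\Omega)$ (identified with its dual), and $\mathcal{G}:=\mathcal{G}_0^{**}=(\mathcal{G}_0^* )^*$ is the biconjugate. Fréchet differentiability on $U$ is understood relative to $U$: for each $\bar u\in U$ there is a bounded linear $S'(\bar u):L^2(\Omega)\to Y$ with $S(u)=S(\bar u)+S'(\bar u)(u-\bar u)+o(\|u-\bar u\|_{L^2(\Omega)})$ as $u\to\bar u$, $u\in U$, and analogously for the second derivative. *)

theory Defs
  imports "HOL-Analysis.Analysis"
begin

text \<open>
  Elements of \<open>L\<^sup>2(\<Omega>)\<close> are represented by functions, two of which denote the same element
  iff they agree almost everywhere on \<open>\<Omega>\<close>. All notions below only depend on the class of a
  function in \<open>L2 \<Omega>\<close>. Values outside \<open>\<Omega>\<close> play no role.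
\<close>

definition L2 :: "'a::euclidean_space set \<Rightarrow> ('a \<Rightarrow> real) set" where
  "L2 \<Omega> = {f \<in> borel_measurable (lebesgue_on \<Omega>). integrable (lebesgue_on \<Omega>) (\<lambda>x. (f x)\<^sup>2)}"

definition L2_inner :: "'a::euclidean_space set \<Rightarrow> ('a \<Rightarrow> real) \<Rightarrow> ('a \<Rightarrow> real) \<Rightarrow> real" where
  "L2_inner \<Omega> f g = (LINT x|lebesgue_on \<Omega>. f x * g x)"

definition L2_norm :: "'a::euclidean_space set \<Rightarrow> ('a \<Rightarrow> real) \<Rightarrow> real" where
  "L2_norm \<Omega> f = sqrt (L2_inner \<Omega> f f)"

definition L2_weak_lim ::
  "'a::euclidean_space set \<Rightarrow> (nat \<Rightarrow> 'a \<Rightarrow> real) \<Rightarrow> ('a \<Rightarrow> real) \<Rightarrow> bool" where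
  "L2_weak_lim \<Omega> f g \<longleftrightarrow> (\<forall>h\<in>L2 \<Omega>. (\<lambda>n. L2_inner \<Omega> (f n) h) \<longlonglongrightarrow> L2_inner \<Omega> g h)"

definition weak_lim :: "(nat \<Rightarrow> 'y::real_inner) \<Rightarrow> 'y \<Rightarrow> bool" where
  "weak_lim y y0 \<longleftrightarrow> (\<forall>h. (\<lambda>n. y n \<bullet> h) \<longlonglongrightarrow> y0 \<bullet> h)"

definition L2_bounded_linear ::
  "'a::euclidean_space set \<Rightarrow> (('a \<Rightarrow> real) \<Rightarrow> 'y::real_normed_vector) \<Rightarrow> bool" where
  "L2_bounded_linear \<Omega> T \<longleftrightarrow>
     (\<forall>f\<in>L2 \<Omega>. \<forall>g\<in>L2 \<Omega>. T (\<lambda>x. f x + g x) = T f + T g) \<and>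
     (\<forall>c. \<forall>f\<in>L2 \<Omega>. T (\<lambda>x. c * f x) = c *\<^sub>R T f) \<and>
     (\<exists>K. \<forall>f\<in>L2 \<Omega>. norm (T f) \<le> K * L2_norm \<Omega> f)"

text \<open>A bounded linear map from \<open>L\<^sup>2(\<Omega>)\<close> into the bounded linear maps \<open>L\<^sup>2(\<Omega>) \<rightarrow> Y\<close>, the latter
  with the operator norm, written in curried form.\<close>

definition L2_bounded_linear2 ::
  "'a::euclidean_space set \<Rightarrow> (('a \<Rightarrow> real) \<Rightarrow> ('a \<Rightarrow> real) \<Rightarrow> 'y::real_normed_vector) \<Rightarrow> bool" where
  "L2_bounded_linear2 \<Omega> B \<longleftrightarrow>
     (\<forall>h\<in>L2 \<Omega>. L2_bounded_linear \<Omega> (B h)) \<and>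
     (\<forall>f\<in>L2 \<Omega>. \<forall>g\<in>L2 \<Omega>. \<forall>k\<in>L2 \<Omega>. B (\<lambda>x. f x + g x) k = B f k + B g k) \<and>
     (\<forall>c. \<forall>f\<in>L2 \<Omega>. \<forall>k\<in>L2 \<Omega>. B (\<lambda>x. c * f x) k = c *\<^sub>R B f k) \<and>
     (\<exists>K. \<forall>h\<in>L2 \<Omega>. \<forall>k\<in>L2 \<Omega>. norm (B h k) \<le> K * L2_norm \<Omega> h * L2_norm \<Omega> k)"

definition L2_frechet_derivative ::
  "'a::euclidean_space set \<Rightarrow> ('a \<Rightarrow> real) set \<Rightarrow> (('a \<Rightarrow> real) \<Rightarrow> 'y::real_normed_vector)
     \<Rightarrow> ('a \<Rightarrow> real) \<Rightarrow> (('a \<Rightarrow> real) \<Rightarrow> 'y) \<Rightarrow> bool" where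
  "L2_frechet_derivative \<Omega> U S u T \<longleftrightarrow>
     L2_bounded_linear \<Omega> T \<and>
     (\<forall>\<epsilon>>0. \<exists>\<delta>>0. \<forall>w\<in>U. L2_norm \<Omega> (\<lambda>x. w x - u x) < \<delta> \<longrightarrow>
        norm (S w - S u - T (\<lambda>x. w x - u x)) \<le> \<epsilon> * L2_norm \<Omega> (\<lambda>x. w x - u x))"

text \<open>The derivative of an operator-valued map \<open>D\<close>. The bound for all \<open>k\<close> says that the operator
  norm of the remainder is at most \<open>\<epsilon> * \<parallel>w - u\<parallel>\<close>.\<close>

definition L2_frechet_derivative_op ::
  "'a::euclidean_space set \<Rightarrow> ('a \<Rightarrow> real) set
     \<Rightarrow> (('a \<Rightarrow> real) \<Rightarrow> ('a \<Rightarrow> real) \<Rightarrow> 'y::real_normed_vector)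
     \<Rightarrow> ('a \<Rightarrow> real) \<Rightarrow> (('a \<Rightarrow> real) \<Rightarrow> ('a \<Rightarrow> real) \<Rightarrow> 'y) \<Rightarrow> bool" where
  "L2_frechet_derivative_op \<Omega> U D u B \<longleftrightarrow>
     L2_bounded_linear2 \<Omega> B \<and>
     (\<forall>\<epsilon>>0. \<exists>\<delta>>0. \<forall>w\<in>U. L2_norm \<Omega> (\<lambda>x. w x - u x) < \<delta> \<longrightarrow>
        (\<forall>k\<in>L2 \<Omega>. norm (D w k - D u k - B (\<lambda>x. w x - u x) k)
                     \<le> \<epsilon> * L2_norm \<Omega> (\<lambda>x. w x - u x) * L2_norm \<Omega> k))"

definition twice_frechet_differentiable ::
  "'a::euclidean_space set \<Rightarrow> ('a \<Rightarrow> real) set \<Rightarrow> (('a \<Rightarrow> real) \<Rightarrow> 'y::real_normed_vector) \<Rightarrow> bool" where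
  "twice_frechet_differentiable \<Omega> U S \<longleftrightarrow>
     (\<exists>D D2. \<forall>u\<in>U. L2_frechet_derivative \<Omega> U S u (D u) \<and>
                    L2_frechet_derivative_op \<Omega> U D u (D2 u))"

text \<open>Constant sequences are allowed, so this also forces \<open>S\<close> to agree on functions of \<open>U\<close> that
  are equal almost everywhere, i.e. to be well defined on classes.\<close>

definition weak_to_weak_continuous ::
  "'a::euclidean_space set \<Rightarrow> ('a \<Rightarrow> real) set \<Rightarrow> (('a \<Rightarrow> real) \<Rightarrow> 'y::real_inner) \<Rightarrow> bool" where
  "weak_to_weak_continuous \<Omega> U S \<longleftrightarrow>
     (\<forall>f u. (\<forall>n. f n \<in> U) \<and> u \<in> U \<and> L2_weak_lim \<Omega> f u \<longrightarrow> weak_lim (\<lambda>n. S (f n)) (S u))"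

text \<open>The prescribed values are \<open>v 1 < \<dots> < v d\<close>.\<close>

definition admissible ::
  "'a::euclidean_space set \<Rightarrow> nat \<Rightarrow> (nat \<Rightarrow> real) \<Rightarrow> ('a \<Rightarrow> real) set" where
  "admissible \<Omega> d v = {u \<in> L2 \<Omega>. AE x in lebesgue_on \<Omega>. u x \<in> {v 1..v d}}"

text \<open>\<open>\<bar>t\<bar>\<^sup>0\<close> with the convention \<open>\<bar>0\<bar>\<^sup>0 = 0\<close>, unlike \<open>0 ^ 0 = 1\<close> in HOL.\<close>

definition abs_pow0 :: "real \<Rightarrow> real" where
  "abs_pow0 t = (if t = 0 then 0 else 1)"

definition indicator_fun :: "'b set \<Rightarrow> 'b \<Rightarrow> ereal" where
  "indicator_fun U u = (if u \<in> U then 0 else \<infinity>)"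

definition G0 ::
  "'a::euclidean_space set \<Rightarrow> nat \<Rightarrow> (nat \<Rightarrow> real) \<Rightarrow> real \<Rightarrow> real \<Rightarrow> ('a \<Rightarrow> real) \<Rightarrow> ereal" where
  "G0 \<Omega> d v \<alpha> \<beta> u =
     ereal (\<alpha> / 2 * (L2_norm \<Omega> u)\<^sup>2
            + \<beta> * (LINT x|lebesgue_on \<Omega>. (\<Prod>i=1..d. abs_pow0 (u x - v i))))
     + indicator_fun (admissible \<Omega> d v) u"

definition L2_conjugate ::
  "'a::euclidean_space set \<Rightarrow> (('a \<Rightarrow> real) \<Rightarrow> ereal) \<Rightarrow> ('a \<Rightarrow> real) \<Rightarrow> ereal" where
  "L2_conjugate \<Omega> F q = (SUP u\<in>L2 \<Omega>. ereal (L2_inner \<Omega> q u) - F u)"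

definition G ::
  "'a::euclidean_space set \<Rightarrow> nat \<Rightarrow> (nat \<Rightarrow> real) \<Rightarrow> real \<Rightarrow> real \<Rightarrow> ('a \<Rightarrow> real) \<Rightarrow> ereal" where
  "G \<Omega> d v \<alpha> \<beta> = L2_conjugate \<Omega> (L2_conjugate \<Omega> (G0 \<Omega> d v \<alpha> \<beta>))"

end

theory Submission
  imports Defs
begin

text \<open>
  The proof is the direct method: a minimizing sequence in the admissible set has a weakly
  convergent subsequence whose limit is again admissible, and the objective is weakly sequentially
  lower semicontinuous.

  Lower semicontinuity rests on the fact that both summands are suprema of weakly continuous
  functions. The biconjugate is by definition a supremum of terms
  \<open>\<langle>u, q\<rangle> - G\<^sub>0\<^sup>*(q)\<close>, and \<open>\<parallel>y - z\<parallel>\<^sup>2 / 2\<close> is the supremum over \<open>h\<close> of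
  \<open>\<langle>y - z, h\<rangle> - \<parallel>h\<parallel>\<^sup>2 / 2\<close>; the latter converges along the subsequence because \<open>S\<close> maps weakly
  convergent sequences to weakly convergent ones. This is
  \<open>half_norm_plus_conjugate_weakly_lsc\<close>, stated for the conjugate of any extended real function.

  Compactness, \<open>L2_between_weakly_sequentially_compact\<close>, is proved directly. A diagonal argument makes \<open>\<langle>f\<^sub>n, f\<^sub>m\<rangle>\<close> converge in \<open>n\<close> for
  each \<open>m\<close>. The functions \<open>h\<close> for which \<open>\<langle>f\<^sub>n, h\<rangle>\<close> converges then form a subspace that contains all
  \<open>f\<^sub>m\<close>. It is everything: the remainder of a near-best approximation of \<open>h\<close> from the subspace is
  nearly orthogonal to all \<open>f\<^sub>m\<close>. This gives a limit functional, and it must be represented by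
  an admissible function. To this end choose elements of almost minimal norm in the decreasing
  convex sets of those admissible \<open>w\<close> with \<open>\<langle>w, h\<rangle> \<ge> inf\<^sub>k\<^sub>\<ge>\<^sub>n \<langle>f\<^sub>k, h\<rangle>\<close> for all \<open>h\<close>. By the
  parallelogram law they form a Cauchy sequence, and their strong limit represents the functional.
\<close>

section \<open>The inner product on square integrable functions\<close>

lemma L2_measurable: "f \<in> L2 \<Omega> \<Longrightarrow> f \<in> borel_measurable (lebesgue_on \<Omega>)"
  by (simp add: L2_def)

lemma L2_square_integrable: "f \<in> L2 \<Omega> \<Longrightarrow> integrable (lebesgue_on \<Omega>) (\<lambda>x. (f x)\<^sup>2)"
  by (simp add: L2_def)

lemma L2_integrable_mult:
  assumes "f \<in> L2 \<Omega>" "g \<in> L2 \<Omega>"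
  shows "integrable (lebesgue_on \<Omega>) (\<lambda>x. f x * g x)"
proof (rule Bochner_Integration.integrable_bound[OF Bochner_Integration.integrable_add[OF assms[THEN L2_square_integrable]]])
  show "(\<lambda>x. f x * g x) \<in> borel_measurable (lebesgue_on \<Omega>)"
    by (rule borel_measurable_times[OF assms[THEN L2_measurable]])
  have "\<bar>s * t\<bar> \<le> s\<^sup>2 + t\<^sup>2" for s t :: real
  proof -
    have "2 * \<bar>s * t\<bar> \<le> s\<^sup>2 + t\<^sup>2"
      using sum_squares_bound[of "\<bar>s\<bar>" "\<bar>t\<bar>"] by (simp add: abs_mult)
    then show ?thesis using abs_ge_zero[of "s * t"] by linarith
  qed
  then show "AE x in lebesgue_on \<Omega>. norm (f x * g x) \<le> norm ((f x)\<^sup>2 + (g x)\<^sup>2)"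
    by simp
qed

lemma L2_add:
  assumes "f \<in> L2 \<Omega>" "g \<in> L2 \<Omega>"
  shows "(\<lambda>x. f x + g x) \<in> L2 \<Omega>"
proof -
  have "integrable (lebesgue_on \<Omega>) (\<lambda>x. (f x)\<^sup>2 + (g x)\<^sup>2 + 2 * (f x * g x))"
    using assms[THEN L2_square_integrable] L2_integrable_mult[OF assms] by simp
  then show ?thesis
    using borel_measurable_add[OF assms[THEN L2_measurable]]
    by (simp add: L2_def power2_sum mult.assoc)
qed

lemma L2_cmult:
  assumes "f \<in> L2 \<Omega>"
  shows "(\<lambda>x. c * f x) \<in> L2 \<Omega>"
  using borel_measurable_times[OF borel_measurable_const[of c] L2_measurable[OF assms]]
    L2_square_integrable[OF assms] by (simp add: L2_def power_mult_distrib)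

lemma L2_inner_commute: "L2_inner \<Omega> f g = L2_inner \<Omega> g f"
  by (simp add: L2_inner_def mult.commute)

lemma L2_inner_add_left:
  "f \<in> L2 \<Omega> \<Longrightarrow> g \<in> L2 \<Omega> \<Longrightarrow> h \<in> L2 \<Omega> \<Longrightarrow>
    L2_inner \<Omega> (\<lambda>x. f x + g x) h = L2_inner \<Omega> f h + L2_inner \<Omega> g h"
  by (simp add: L2_inner_def distrib_right L2_integrable_mult)

lemma L2_inner_cmult_left: "L2_inner \<Omega> (\<lambda>x. c * f x) h = c * L2_inner \<Omega> f h"
  by (simp add: L2_inner_def mult.assoc)

lemma L2_inner_add_right:
  "f \<in> L2 \<Omega> \<Longrightarrow> g \<in> L2 \<Omega> \<Longrightarrow> h \<in> L2 \<Omega> \<Longrightarrow>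
    L2_inner \<Omega> h (\<lambda>x. f x + g x) = L2_inner \<Omega> h f + L2_inner \<Omega> h g"
  unfolding L2_inner_commute[of \<Omega> h] by (rule L2_inner_add_left)

lemma L2_inner_cmult_right: "L2_inner \<Omega> h (\<lambda>x. c * f x) = c * L2_inner \<Omega> h f"
  unfolding L2_inner_commute[of \<Omega> h] by (rule L2_inner_cmult_left)

lemma L2_diff: "f \<in> L2 \<Omega> \<Longrightarrow> g \<in> L2 \<Omega> \<Longrightarrow> (\<lambda>x. f x - g x) \<in> L2 \<Omega>"
  using L2_add[of f \<Omega> "\<lambda>x. (-1) * g x"] L2_cmult[of g \<Omega> "-1"] by simp

lemma L2_inner_diff_left:
  assumes "f \<in> L2 \<Omega>" "g \<in> L2 \<Omega>" "h \<in> L2 \<Omega>"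
  shows "L2_inner \<Omega> (\<lambda>x. f x - g x) h = L2_inner \<Omega> f h - L2_inner \<Omega> g h"
  using assms by (simp add: L2_inner_def left_diff_distrib L2_integrable_mult)

lemma L2_inner_diff_right:
  "f \<in> L2 \<Omega> \<Longrightarrow> g \<in> L2 \<Omega> \<Longrightarrow> h \<in> L2 \<Omega> \<Longrightarrow>
    L2_inner \<Omega> h (\<lambda>x. f x - g x) = L2_inner \<Omega> h f - L2_inner \<Omega> h g"
  unfolding L2_inner_commute[of \<Omega> h] by (rule L2_inner_diff_left)

lemma L2_inner_minus_right: "L2_inner \<Omega> h (\<lambda>x. - f x) = - L2_inner \<Omega> h f"
  by (simp add: L2_inner_def)

lemma L2_inner_self_nonneg: "0 \<le> L2_inner \<Omega> f f"
  by (simp add: L2_inner_def)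

lemmas L2_inner_bilinear =
  L2_inner_add_left L2_inner_add_right L2_inner_diff_left L2_inner_diff_right
  L2_inner_cmult_left L2_inner_cmult_right L2_add L2_diff L2_cmult

lemma L2_inner_abs_le:
  assumes "f \<in> L2 \<Omega>" "g \<in> L2 \<Omega>"
  shows "2 * \<bar>L2_inner \<Omega> f g\<bar> \<le> L2_inner \<Omega> f f + L2_inner \<Omega> g g"
proof -
  have "0 \<le> L2_inner \<Omega> (\<lambda>x. f x + g x) (\<lambda>x. f x + g x)"
    and "0 \<le> L2_inner \<Omega> (\<lambda>x. f x - g x) (\<lambda>x. f x - g x)"
    by (rule L2_inner_self_nonneg)+
  then show ?thesis
    using assms by (simp add: L2_inner_bilinear L2_inner_commute[of \<Omega> g f])
qed

section \<open>Weakly Cauchy subsequences of bounded sequences\<close>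

text \<open>A substitute for the orthogonal projection onto a subspace \<open>M\<close> that is not known to be
  closed. If \<open>g\<close> minimizes the squared distance to \<open>h\<close> up to \<open>\<epsilon>\<^sup>2\<close>, then moving from \<open>g\<close> by
  \<open>\<plusminus>\<epsilon> k\<close> gains at most \<open>\<epsilon>\<^sup>2\<close>, which bounds the first-order term \<open>2 \<epsilon> \<bar>\<langle>h - g, k\<rangle>\<bar>\<close>.\<close>

lemma L2_near_best_approximation:
  assumes M: "M \<subseteq> L2 \<Omega>" "M \<noteq> {}"
    and sub: "\<And>g k c. g \<in> M \<Longrightarrow> k \<in> M \<Longrightarrow> (\<lambda>x. g x + c * k x) \<in> M"
    and h: "h \<in> L2 \<Omega>" and "0 < \<epsilon>"
  obtains g where "g \<in> M"
    and "\<And>k. k \<in> M \<Longrightarrow> 2 * \<bar>L2_inner \<Omega> (\<lambda>x. h x - g x) k\<bar> \<le> \<epsilon> * (1 + L2_inner \<Omega> k k)"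
proof -
  define \<rho> where "\<rho> g = L2_inner \<Omega> (\<lambda>x. h x - g x) (\<lambda>x. h x - g x)" for g
  have bdd: "bdd_below (\<rho> ` M)"
    by (rule bdd_belowI[of _ 0]) (auto simp: \<rho>_def L2_inner_self_nonneg)
  have "Inf (\<rho> ` M) < Inf (\<rho> ` M) + \<epsilon>\<^sup>2" using \<open>0 < \<epsilon>\<close> by simp
  then obtain g where g: "g \<in> M" and "\<rho> g < Inf (\<rho> ` M) + \<epsilon>\<^sup>2"
    using cInf_lessD[of "\<rho> ` M"] M(2) by blast
  then have near: "\<rho> g \<le> \<rho> k + \<epsilon>\<^sup>2" if "k \<in> M" for k
    using cINF_lower[OF bdd that] by linarith
  show thesis
  proof (rule that[OF g])
    fix k assume k: "k \<in> M"
    let ?r = "\<lambda>x. h x - g x"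
    have L: "?r \<in> L2 \<Omega>" "k \<in> L2 \<Omega>" using M h g k by (auto intro!: L2_diff)
    have M_L2: "h \<in> L2 \<Omega>" "g \<in> L2 \<Omega>" using M h g by auto
    have eq: "\<rho> (\<lambda>x. g x + c * k x) = \<rho> g - 2 * c * L2_inner \<Omega> ?r k + c\<^sup>2 * L2_inner \<Omega> k k" for c
    proof -
      have "\<rho> (\<lambda>x. g x + c * k x) =
          L2_inner \<Omega> (\<lambda>x. ?r x - c * k x) (\<lambda>x. ?r x - c * k x)"
        unfolding \<rho>_def by (simp add: algebra_simps)
      also have "\<dots> = \<rho> g - 2 * c * L2_inner \<Omega> ?r k + c\<^sup>2 * L2_inner \<Omega> k k"
        unfolding \<rho>_def using L M_L2
        by (simp add: L2_inner_bilinear L2_inner_commute[of \<Omega> k h] L2_inner_commute[of \<Omega> k g] L2_inner_commute[of \<Omega> g h] power2_eq_square algebra_simps)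
      finally show ?thesis .
    qed
    have "2 * c * L2_inner \<Omega> ?r k \<le> c\<^sup>2 * L2_inner \<Omega> k k + \<epsilon>\<^sup>2" for c
      using near[OF sub[OF g k, of c]] eq[of c] by linarith
    from this[of \<epsilon>] this[of "-\<epsilon>"]
    have "\<epsilon> * (2 * \<bar>L2_inner \<Omega> ?r k\<bar>) \<le> \<epsilon> * (\<epsilon> * (1 + L2_inner \<Omega> k k))"
      by (cases "L2_inner \<Omega> ?r k \<ge> 0") (simp_all add: power2_eq_square algebra_simps)
    then show "2 * \<bar>L2_inner \<Omega> ?r k\<bar> \<le> \<epsilon> * (1 + L2_inner \<Omega> k k)"
      using \<open>0 < \<epsilon>\<close> by (meson mult_le_cancel_left_pos)
  qed
qed

text \<open>The rows of \<open>a\<close> lie in a product of countably many compact intervals, which is compact and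
  metrizable, hence sequentially compact.\<close>

lemma bounded_double_sequence_diagonal_subseq:
  fixes a :: "nat \<Rightarrow> nat \<Rightarrow> real"
  assumes "\<And>n m. \<bar>a n m\<bar> \<le> K"
  obtains r where "strict_mono r" and "\<And>m. convergent (\<lambda>n. a (r n) m)"
proof -
  have "compact (PiE UNIV (\<lambda>_::nat. {- K..K}))"
    using compactin_PiE[of "\<lambda>_. euclidean" UNIV "\<lambda>_::nat. {-K..K}"]
    by (simp add: euclidean_product_topology)
  then have "seq_compact (PiE UNIV (\<lambda>_::nat. {- K..K}))"
    by (rule compact_imp_seq_compact)
  moreover have "\<forall>n. a n \<in> PiE UNIV (\<lambda>_. {- K..K})"
    using assms by (auto simp: abs_le_iff) (metis minus_le_iff)
  ultimately obtain l r where r: "strict_mono r" and l: "(a \<circ> r) \<longlonglongrightarrow> l"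
    unfolding seq_compact_def by meson
  have "(\<lambda>n. (a \<circ> r) n m) \<longlonglongrightarrow> l m" for m
    using continuous_on_tendsto_compose[OF continuous_on_product_coordinates[of m] l] by simp
  then show thesis using that r by (auto simp: convergent_def)
qed

text \<open>The only inner products that need to be controlled by hand are those among the members of
  the sequence. They decide the rest, since a function orthogonal to all members contributes zero.\<close>

lemma L2_bounded_imp_weakly_Cauchy_subseq:
  fixes f :: "nat \<Rightarrow> 'a::euclidean_space \<Rightarrow> real"
  assumes f: "\<And>n. f n \<in> L2 \<Omega>" and K: "\<And>n. L2_inner \<Omega> (f n) (f n) \<le> K"
  obtains r where "strict_mono r" and "\<And>h. h \<in> L2 \<Omega> \<Longrightarrow> convergent (\<lambda>n. L2_inner \<Omega> (f (r n)) h)"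
proof -
  have "\<bar>L2_inner \<Omega> (f n) (f m)\<bar> \<le> K" for n m
    using L2_inner_abs_le[OF f f, of n m] K[of n] K[of m] by linarith
  then obtain r where r: "strict_mono r"
    and conv: "\<And>m. convergent (\<lambda>n. L2_inner \<Omega> (f (r n)) (f m))"
    using bounded_double_sequence_diagonal_subseq[of "\<lambda>n m. L2_inner \<Omega> (f n) (f m)"] by metis
  define M where "M = {g \<in> L2 \<Omega>. convergent (\<lambda>n. L2_inner \<Omega> (f (r n)) g)}"
  have fM: "f m \<in> M" for m using f conv by (simp add: M_def)
  have sub: "(\<lambda>x. g x + c * k x) \<in> M" if "g \<in> M" "k \<in> M" for g k c
    using that f by (auto simp: M_def L2_inner_bilinear intro!: convergent_add convergent_mult convergent_const)
  have "convergent (\<lambda>n. L2_inner \<Omega> (f (r n)) h)" if h: "h \<in> L2 \<Omega>" for h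
  proof (rule Cauchy_convergent, rule metric_CauchyI)
    fix e :: real assume e: "0 < e"
    have K0: "0 \<le> K" using K[of 0] L2_inner_self_nonneg[of \<Omega> "f 0"] by linarith
    \<comment> \<open>The remainder then contributes at most \<open>e / 4\<close> for each of the two indices compared.\<close>
    define \<epsilon> where "\<epsilon> = e / (2 * (1 + K))"
    have \<epsilon>: "0 < \<epsilon>" "\<epsilon> * (1 + K) = e / 2" using e K0 by (auto simp: \<epsilon>_def field_simps)
    obtain g where g: "g \<in> M"
      and small: "\<And>k. k \<in> M \<Longrightarrow> 2 * \<bar>L2_inner \<Omega> (\<lambda>x. h x - g x) k\<bar> \<le> \<epsilon> * (1 + L2_inner \<Omega> k k)"
    proof (rule L2_near_best_approximation[of M \<Omega> h \<epsilon>])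
      show "M \<subseteq> L2 \<Omega>" "M \<noteq> {}" using fM by (auto simp: M_def)
    qed (use sub h \<epsilon>(1) in auto)
    have gL: "g \<in> L2 \<Omega>" using g by (simp add: M_def)
    have near: "\<bar>L2_inner \<Omega> (f n) h - L2_inner \<Omega> (f n) g\<bar> \<le> e / 4" for n
    proof -
      have "L2_inner \<Omega> (\<lambda>x. h x - g x) (f n) = L2_inner \<Omega> (f n) h - L2_inner \<Omega> (f n) g"
        using f h gL by (simp add: L2_inner_bilinear L2_inner_commute[of \<Omega> h "f n"] L2_inner_commute[of \<Omega> g "f n"])
      moreover have "\<epsilon> * (1 + L2_inner \<Omega> (f n) (f n)) \<le> e / 2"
        using \<epsilon> K[of n] by (metis add_left_mono less_imp_le mult_left_mono)
      ultimately show ?thesis using small[OF fM[of n]] by simp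
    qed
    have "Cauchy (\<lambda>n. L2_inner \<Omega> (f (r n)) g)"
      using g by (simp add: M_def convergent_Cauchy)
    then obtain N where N: "\<And>m n. m \<ge> N \<Longrightarrow> n \<ge> N \<Longrightarrow>
        dist (L2_inner \<Omega> (f (r m)) g) (L2_inner \<Omega> (f (r n)) g) < e / 2"
      using e metric_CauchyD[of _ "e/2"] by (metis half_gt_zero)
    have "dist (L2_inner \<Omega> (f (r m)) h) (L2_inner \<Omega> (f (r n)) h) < e" if "m \<ge> N" "n \<ge> N" for m n
      using N[OF that] near[of "r m"] near[of "r n"] unfolding dist_real_def by linarith
    then show "\<exists>N. \<forall>m\<ge>N. \<forall>n\<ge>N. dist (L2_inner \<Omega> (f (r m)) h) (L2_inner \<Omega> (f (r n)) h) < e"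
      by blast
  qed
  then show thesis using that r by blast
qed

section \<open>Weak sequential compactness of order intervals\<close>

definition L2_between :: "'a::euclidean_space set \<Rightarrow> real \<Rightarrow> real \<Rightarrow> ('a \<Rightarrow> real) set" where
  "L2_between \<Omega> a b = {u \<in> L2 \<Omega>. AE x in lebesgue_on \<Omega>. u x \<in> {a..b}}"

lemma abs_le_of_between: "s \<in> {a..b} \<Longrightarrow> \<bar>s\<bar> \<le> \<bar>a\<bar> + \<bar>b\<bar>" for a b s :: real
  by auto

lemma L2_betweenI:
  assumes "\<Omega> \<in> lmeasurable" and "u \<in> borel_measurable (lebesgue_on \<Omega>)"
    and b: "AE x in lebesgue_on \<Omega>. u x \<in> {a..b}"
  shows "u \<in> L2_between \<Omega> a b"
proof -
  interpret finite_measure "lebesgue_on \<Omega>" by (rule finite_measure_lebesgue_on) fact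
  have "AE x in lebesgue_on \<Omega>. norm ((u x)\<^sup>2) \<le> (\<bar>a\<bar> + \<bar>b\<bar>)\<^sup>2"
    using b by eventually_elim (metis abs_le_of_between abs_ge_zero norm_power power_mono real_norm_def)
  then have "integrable (lebesgue_on \<Omega>) (\<lambda>x. (u x)\<^sup>2)"
    using assms(2) by (intro integrable_const_bound) auto
  then show ?thesis using assms by (simp add: L2_between_def L2_def)
qed

lemma L2_between_inner_self_le:
  assumes "\<Omega> \<in> lmeasurable" and u: "u \<in> L2_between \<Omega> a b"
  shows "L2_inner \<Omega> u u \<le> (\<bar>a\<bar> + \<bar>b\<bar>)\<^sup>2 * measure lebesgue \<Omega>"
proof -
  interpret finite_measure "lebesgue_on \<Omega>" by (rule finite_measure_lebesgue_on) fact
  have "AE x in lebesgue_on \<Omega>. u x \<in> {a..b}" using u by (simp add: L2_between_def)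
  then have "AE x in lebesgue_on \<Omega>. u x * u x \<le> (\<bar>a\<bar> + \<bar>b\<bar>)\<^sup>2"
    by eventually_elim (metis abs_le_of_between abs_ge_zero power2_abs power2_eq_square power_mono)
  then have "L2_inner \<Omega> u u \<le> (LINT x|lebesgue_on \<Omega>. (\<bar>a\<bar> + \<bar>b\<bar>)\<^sup>2)"
    unfolding L2_inner_def using u
    by (intro integral_mono_AE) (auto simp: L2_between_def L2_integrable_mult)
  also have "\<dots> = (\<bar>a\<bar> + \<bar>b\<bar>)\<^sup>2 * measure lebesgue \<Omega>"
    using assms(1) by (simp add: measure_restrict_space)
  finally show ?thesis .
qed

lemma L2_between_midpoint:
  assumes "u \<in> L2_between \<Omega> a b" "w \<in> L2_between \<Omega> a b"
  shows "(\<lambda>x. 1/2 * u x + 1/2 * w x) \<in> L2_between \<Omega> a b"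
proof -
  have "AE x in lebesgue_on \<Omega>. u x \<in> {a..b}" "AE x in lebesgue_on \<Omega>. w x \<in> {a..b}"
    using assms by (auto simp: L2_between_def)
  then have "AE x in lebesgue_on \<Omega>. 1/2 * u x + 1/2 * w x \<in> {a..b}"
    by eventually_elim auto
  then show ?thesis using assms L2_add[OF L2_cmult L2_cmult, of u \<Omega> w "1/2" "1/2"]
    unfolding L2_between_def by blast
qed

text \<open>On a set of finite measure a sequence that is Cauchy in \<open>L\<^sup>2\<close> is Cauchy in \<open>L\<^sup>1\<close>, so a subsequence
  converges almost everywhere. The uniform bounds pass to the limit and make dominated convergence
  applicable to the inner products.\<close>

lemma L2_between_Cauchy_imp_limit:
  fixes w :: "nat \<Rightarrow> 'a::euclidean_space \<Rightarrow> real"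
  assumes \<Omega>: "\<Omega> \<in> lmeasurable" and w: "\<And>n. w n \<in> L2_between \<Omega> a b"
    and Cauchy: "\<And>e. 0 < e \<Longrightarrow>
      \<exists>N. \<forall>i\<ge>N. \<forall>j\<ge>N. L2_inner \<Omega> (\<lambda>x. w i x - w j x) (\<lambda>x. w i x - w j x) < e"
  obtains u s where "u \<in> L2_between \<Omega> a b" and "strict_mono s"
    and "\<And>h. h \<in> L2 \<Omega> \<Longrightarrow> (\<lambda>n. L2_inner \<Omega> (w (s n)) h) \<longlonglongrightarrow> L2_inner \<Omega> u h"
proof -
  let ?M = "lebesgue_on \<Omega>" and ?\<mu> = "measure lebesgue \<Omega>"
  interpret finite_measure ?M by (rule finite_measure_lebesgue_on) fact
  have wL: "w n \<in> L2 \<Omega>" and wab: "AE x in ?M. w n x \<in> {a..b}" for n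
    using w by (auto simp: L2_between_def)
  have wm[measurable]: "w n \<in> borel_measurable ?M" for n using wL by (simp add: L2_def)
  have wint: "integrable ?M (w n)" for n
  proof (rule integrable_const_bound[OF _ wm])
    show "AE x in ?M. norm (w n x) \<le> \<bar>a\<bar> + \<bar>b\<bar>"
      using wab[of n] by eventually_elim (metis abs_le_of_between real_norm_def)
  qed
  have L1: "\<exists>N. \<forall>i\<ge>N. \<forall>j\<ge>N. LINT x|?M. norm (w i x - w j x) < e" if e: "0 < e" for e :: real
  proof -
    \<comment> \<open>The \<open>L\<^sup>1\<close> norm is estimated by \<open>\<bar>t\<bar> \<le> \<eta> / 2 + t\<^sup>2 / (2 * \<eta>)\<close>. This \<open>\<eta>\<close> makes both halves integrate to
      at most \<open>e / 2\<close> once the squared distance is below \<open>e * \<eta>\<close>; the summand \<open>1\<close> covers null sets.\<close>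
    define \<eta> where "\<eta> = e / (?\<mu> + 1)"
    have mu0: "0 \<le> ?\<mu>" by simp
    then have \<eta>: "0 < \<eta>" using e by (simp add: \<eta>_def add_nonneg_pos)
    obtain N where N: "\<And>i j. i \<ge> N \<Longrightarrow> j \<ge> N \<Longrightarrow>
        L2_inner \<Omega> (\<lambda>x. w i x - w j x) (\<lambda>x. w i x - w j x) < e * \<eta>"
      using Cauchy[of "e * \<eta>"] e \<eta> by auto
    have "(LINT x|?M. norm (w i x - w j x)) < e" if ij: "i \<ge> N" "j \<ge> N" for i j
    proof -
      have D: "(\<lambda>x. w i x - w j x) \<in> L2 \<Omega>"
        using wL by (intro L2_diff)
      have young: "\<bar>t\<bar> \<le> \<eta> / 2 + (t * t) / (2 * \<eta>)" for t
      proof -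
        have "0 \<le> (\<bar>t\<bar> - \<eta>)\<^sup>2" by simp
        then have "2 * \<eta> * \<bar>t\<bar> \<le> \<eta> * \<eta> + t * t" by (simp add: power2_eq_square algebra_simps)
        then show ?thesis using \<eta> by (simp add: field_simps)
      qed
      have "(LINT x|?M. norm (w i x - w j x))
          \<le> (LINT x|?M. \<eta> / 2 + ((w i x - w j x) * (w i x - w j x)) / (2 * \<eta>))"
        using wint young L2_integrable_mult[OF D D] by (intro integral_mono) auto
      also have "\<dots> = \<eta> / 2 * ?\<mu> + L2_inner \<Omega> (\<lambda>x. w i x - w j x) (\<lambda>x. w i x - w j x) / (2 * \<eta>)"
        using \<Omega> L2_integrable_mult[OF D D] by (simp add: L2_inner_def measure_restrict_space)
      also have "\<dots> < \<eta> / 2 * ?\<mu> + (e * \<eta>) / (2 * \<eta>)"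
        using N[OF ij] \<eta> by (intro add_strict_left_mono divide_strict_right_mono) simp_all
      also have "\<dots> \<le> e"
      proof -
        have "?\<mu> + 1 \<noteq> 0" using mu0 by linarith
        then have "\<eta> * (?\<mu> + 1) = e" by (simp add: \<eta>_def)
        then show ?thesis using \<eta> by (simp add: algebra_simps)
      qed
      finally show ?thesis .
    qed
    then show ?thesis by blast
  qed
  obtain s where s: "strict_mono s" and C: "AE x in ?M. Cauchy (\<lambda>i. w (s i) x)"
    using cauchy_L1_AE_cauchy_subseq[OF wint L1] by blast
  define u where "u x = lim (\<lambda>i. w (s i) x)" for x
  have um[measurable]: "u \<in> borel_measurable ?M" unfolding u_def by measurable
  have lim: "AE x in ?M. (\<lambda>i. w (s i) x) \<longlonglongrightarrow> u x"
    using C by eventually_elim (simp add: u_def Cauchy_convergent_iff convergent_LIMSEQ_iff)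
  have all: "AE x in ?M. \<forall>i. w (s i) x \<in> {a..b}" using wab by (simp add: AE_all_countable)
  have "AE x in ?M. u x \<in> {a..b}"
    using lim all by eventually_elim (metis closed_sequentially closed_atLeastAtMost)
  then have u: "u \<in> L2_between \<Omega> a b" by (intro L2_betweenI \<Omega> um)
  have "(\<lambda>n. L2_inner \<Omega> (w (s n)) h) \<longlonglongrightarrow> L2_inner \<Omega> u h" if h: "h \<in> L2 \<Omega>" for h
    unfolding L2_inner_def
  proof (rule integral_dominated_convergence[where w="\<lambda>x. (\<bar>a\<bar> + \<bar>b\<bar>) * \<bar>h x\<bar>"])
    have [measurable]: "h \<in> borel_measurable ?M" using h by (simp add: L2_def)
    show "(\<lambda>x. u x * h x) \<in> borel_measurable ?M" "\<And>i. (\<lambda>x. w (s i) x * h x) \<in> borel_measurable ?M"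
      by measurable
    have "(\<lambda>_. 1) \<in> L2 \<Omega>" by (simp add: L2_def)
    from L2_integrable_mult[OF this h] show "integrable ?M (\<lambda>x. (\<bar>a\<bar> + \<bar>b\<bar>) * \<bar>h x\<bar>)"
      by simp
    show "AE x in ?M. (\<lambda>i. w (s i) x * h x) \<longlonglongrightarrow> u x * h x"
      using lim by eventually_elim (intro tendsto_intros)
    show "AE x in ?M. norm (w (s i) x * h x) \<le> (\<bar>a\<bar> + \<bar>b\<bar>) * \<bar>h x\<bar>" for i
      using wab[of "s i"]
      by eventually_elim (metis abs_ge_zero abs_le_of_between abs_mult mult_right_mono real_norm_def)
  qed
  then show thesis using that u s by blast
qed

text \<open>A weakly Cauchy subsequence need not converge strongly, but convex combinations of its tails
  of nearly least norm do, and they have the same limiting inner products.\<close>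

lemma L2_between_weakly_sequentially_compact:
  fixes f :: "nat \<Rightarrow> 'a::euclidean_space \<Rightarrow> real"
  assumes \<Omega>: "\<Omega> \<in> lmeasurable" and f: "\<And>n. f n \<in> L2_between \<Omega> a b"
  obtains u r where "u \<in> L2_between \<Omega> a b" and "strict_mono r"
    and "L2_weak_lim \<Omega> (\<lambda>n. f (r n)) u"
proof -
  let ?U = "L2_between \<Omega> a b"
  define K where "K = (\<bar>a\<bar> + \<bar>b\<bar>)\<^sup>2 * measure lebesgue \<Omega>"
  have UL: "?U \<subseteq> L2 \<Omega>" by (auto simp: L2_between_def)
  have UK: "L2_inner \<Omega> u u \<le> K" if "u \<in> ?U" for u
    using L2_between_inner_self_le[OF \<Omega> that] by (simp add: K_def)
  obtain r where r: "strict_mono r"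
    and conv: "\<And>h. h \<in> L2 \<Omega> \<Longrightarrow> convergent (\<lambda>n. L2_inner \<Omega> (f (r n)) h)"
    using L2_bounded_imp_weakly_Cauchy_subseq[of f \<Omega> K] f UL UK by blast
  define l where "l h = lim (\<lambda>n. L2_inner \<Omega> (f (r n)) h)" for h
  have l: "(\<lambda>n. L2_inner \<Omega> (f (r n)) h) \<longlonglongrightarrow> l h" if "h \<in> L2 \<Omega>" for h
    using conv[OF that] by (simp add: l_def convergent_LIMSEQ_iff)
  \<comment> \<open>The set \<open>C n\<close> is a stand-in for the closed convex hull of the tail \<open>f (r k)\<close>, \<open>k \<ge> n\<close>: an
    intersection of half-spaces, for which convexity is immediate. Half-spaces for \<open>h\<close> and \<open>- h\<close>
    together force inner products towards \<open>l h\<close>.\<close>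
  define C where "C n = {w \<in> ?U. \<forall>h\<in>L2 \<Omega>. \<forall>c. (\<forall>k\<ge>n. c \<le> L2_inner \<Omega> (f (r k)) h) \<longrightarrow> c \<le> L2_inner \<Omega> w h}"
    for n :: nat
  have CU: "C n \<subseteq> ?U" for n by (auto simp: C_def)
  have C_anti: "C m \<subseteq> C n" if "n \<le> m" for n m using that unfolding C_def by (auto intro: order_trans)
  have fC: "f (r n) \<in> C n" for n using f by (auto simp: C_def)
  have C_mid: "(\<lambda>x. 1/2 * u x + 1/2 * w x) \<in> C n" if uw: "u \<in> C n" "w \<in> C n" for u w n
  proof -
    have "u \<in> L2 \<Omega>" "w \<in> L2 \<Omega>" using uw CU UL by blast+
    then have "L2_inner \<Omega> (\<lambda>x. 1/2 * u x + 1/2 * w x) h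
        = 1/2 * L2_inner \<Omega> u h + 1/2 * L2_inner \<Omega> w h" if "h \<in> L2 \<Omega>" for h
      using that by (simp only: L2_inner_bilinear)
    moreover have "(\<lambda>x. 1/2 * u x + 1/2 * w x) \<in> ?U"
      using uw CU by (intro L2_between_midpoint) blast+
    moreover have "c \<le> 1/2 * L2_inner \<Omega> u h + 1/2 * L2_inner \<Omega> w h"
      if "h \<in> L2 \<Omega>" "\<forall>k\<ge>n. c \<le> L2_inner \<Omega> (f (r k)) h" for c h
    proof -
      have "c \<le> L2_inner \<Omega> u h" "c \<le> L2_inner \<Omega> w h" using uw that unfolding C_def by blast+
      then show ?thesis by linarith
    qed
    ultimately show ?thesis unfolding C_def by simp
  qed
  have C_weak: "(\<lambda>n. L2_inner \<Omega> (w n) h) \<longlonglongrightarrow> l h" if w: "\<And>n. w n \<in> C n" and h: "h \<in> L2 \<Omega>" for w h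
  proof (rule LIMSEQ_I)
    fix e :: real assume "0 < e"
    then obtain N where N: "\<And>k. k \<ge> N \<Longrightarrow> \<bar>L2_inner \<Omega> (f (r k)) h - l h\<bar> < e / 2"
      using LIMSEQ_D[OF l[OF h], of "e/2"] by auto
    have "\<bar>L2_inner \<Omega> (w n) h - l h\<bar> < e" if "n \<ge> N" for n
    proof -
      have lower: "\<forall>k\<ge>n. l h - e/2 \<le> L2_inner \<Omega> (f (r k)) h"
        using N \<open>n \<ge> N\<close> by (smt (verit) le_trans)
      have upper: "\<forall>k\<ge>n. - l h - e/2 \<le> L2_inner \<Omega> (f (r k)) (\<lambda>x. - h x)"
        unfolding L2_inner_minus_right using N \<open>n \<ge> N\<close> by (smt (verit) le_trans)
      have "l h - e/2 \<le> L2_inner \<Omega> (w n) h"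
        using w[of n] h lower unfolding C_def by blast
      moreover have "- l h - e/2 \<le> L2_inner \<Omega> (w n) (\<lambda>x. - h x)"
        using w[of n] L2_cmult[OF h, of "-1"] upper unfolding C_def by simp
      ultimately show ?thesis using \<open>0 < e\<close> by (simp add: L2_inner_minus_right)
    qed
    then show "\<exists>N. \<forall>n\<ge>N. norm (L2_inner \<Omega> (w n) h - l h) < e" by auto
  qed
  define \<delta> where "\<delta> n = (INF w\<in>C n. L2_inner \<Omega> w w)" for n
  have bdd: "bdd_below ((\<lambda>w. L2_inner \<Omega> w w) ` C n)" for n
    by (rule bdd_belowI[of _ 0]) (auto simp: L2_inner_self_nonneg)
  have ne: "C n \<noteq> {}" for n using fC by blast
  have \<delta>_le: "\<delta> n \<le> L2_inner \<Omega> w w" if "w \<in> C n" for n w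
    unfolding \<delta>_def by (rule cINF_lower[OF bdd that])
  have \<delta>_mono: "\<delta> n \<le> \<delta> m" if "n \<le> m" for n m
    unfolding \<delta>_def using C_anti[OF that] by (intro cINF_superset_mono bdd ne) auto
  have \<delta>_K: "\<delta> n \<le> K" for n using \<delta>_le[OF fC] UK[OF f] by (meson order_trans)
  obtain L where L: "\<delta> \<longlonglongrightarrow> L" and \<delta>_L: "\<And>n. \<delta> n \<le> L"
    using incseq_convergent[of \<delta> K] \<delta>_mono \<delta>_K by (auto simp: incseq_def)
  have "\<exists>w\<in>C n. L2_inner \<Omega> w w < \<delta> n + 1 / Suc n" for n
  proof -
    have "\<delta> n < \<delta> n + 1 / Suc n" by simp
    then show ?thesis unfolding \<delta>_def using cINF_less_iff[OF ne bdd] by blast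
  qed
  then obtain w where wC: "\<And>n. w n \<in> C n" and w_near: "\<And>n. L2_inner \<Omega> (w n) (w n) < \<delta> n + 1 / Suc n"
    by metis
  have wL: "w n \<in> L2 \<Omega>" for n using wC CU UL by blast
  define \<kappa> where "\<kappa> n = 2 * (L - \<delta> n) + 4 * (1 / Suc n)" for n
  \<comment> \<open>For \<open>i \<le> j\<close> the midpoint of \<open>w i\<close> and \<open>w j\<close> lies in \<open>C i\<close>, so its squared norm is at least
    \<open>\<delta> i\<close>; the parallelogram law leaves little room for the difference.\<close>
  have dist_le: "L2_inner \<Omega> (\<lambda>x. w i x - w j x) (\<lambda>x. w i x - w j x) \<le> \<kappa> i" if "i \<le> j" for i j
  proof -
    have "\<delta> i \<le> L2_inner \<Omega> (\<lambda>x. 1/2 * w i x + 1/2 * w j x) (\<lambda>x. 1/2 * w i x + 1/2 * w j x)"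
      using \<delta>_le C_mid wC C_anti that by blast
    also have "4 * \<dots> = L2_inner \<Omega> (w i) (w i) + 2 * L2_inner \<Omega> (w i) (w j) + L2_inner \<Omega> (w j) (w j)"
      using wL by (simp only: L2_inner_bilinear L2_inner_commute[of \<Omega> "w j" "w i"]) (simp add: field_simps)
    finally have "4 * \<delta> i \<le> \<dots>" by simp
    moreover have "L2_inner \<Omega> (\<lambda>x. w i x - w j x) (\<lambda>x. w i x - w j x)
        = L2_inner \<Omega> (w i) (w i) - 2 * L2_inner \<Omega> (w i) (w j) + L2_inner \<Omega> (w j) (w j)"
      using wL by (simp add: L2_inner_bilinear L2_inner_commute[of \<Omega> "w j" "w i"])
    moreover have "1 / real (Suc j) \<le> 1 / real (Suc i)" using that by (simp add: frac_le)
    ultimately show ?thesis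
      using w_near[of i] w_near[of j] \<delta>_L[of j] by (simp add: \<kappa>_def)
  qed
  have "\<kappa> \<longlonglongrightarrow> 2 * (L - L) + 4 * 0"
    unfolding \<kappa>_def by (intro tendsto_intros L LIMSEQ_Suc lim_1_over_n)
  then have \<kappa>: "\<kappa> \<longlonglongrightarrow> 0" by simp
  have Cauchy: "\<exists>N. \<forall>i\<ge>N. \<forall>j\<ge>N. L2_inner \<Omega> (\<lambda>x. w i x - w j x) (\<lambda>x. w i x - w j x) < e"
    if e: "0 < e" for e
  proof -
    obtain N where N: "\<And>n. n \<ge> N \<Longrightarrow> \<kappa> n < e"
      using order_tendstoD(2)[OF \<kappa> e] unfolding eventually_sequentially by blast
    have "L2_inner \<Omega> (\<lambda>x. w i x - w j x) (\<lambda>x. w i x - w j x) < e" if "i \<ge> N" "j \<ge> N" for i j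
    proof (cases "i \<le> j")
      case True then show ?thesis using dist_le[of i j] N[of i] that by linarith
    next
      case False
      have "L2_inner \<Omega> (\<lambda>x. w i x - w j x) (\<lambda>x. w i x - w j x)
          = L2_inner \<Omega> (\<lambda>x. w j x - w i x) (\<lambda>x. w j x - w i x)"
        by (simp add: L2_inner_def algebra_simps)
      then show ?thesis using dist_le[of j i] N[of j] that False by linarith
    qed
    then show ?thesis by blast
  qed
  obtain u s where u: "u \<in> ?U" and s: "strict_mono s"
    and us: "\<And>h. h \<in> L2 \<Omega> \<Longrightarrow> (\<lambda>n. L2_inner \<Omega> (w (s n)) h) \<longlonglongrightarrow> L2_inner \<Omega> u h"
    using L2_between_Cauchy_imp_limit[OF \<Omega> _ Cauchy] wC CU by blast
  have "L2_inner \<Omega> u h = l h" if h: "h \<in> L2 \<Omega>" for h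
    using us[OF h] LIMSEQ_subseq_LIMSEQ[OF C_weak[OF wC h] s] by (auto simp: o_def intro: LIMSEQ_unique)
  then have "L2_weak_lim \<Omega> (\<lambda>n. f (r n)) u" using l by (simp add: L2_weak_lim_def)
  then show thesis using that u r by blast
qed

section \<open>Weak lower semicontinuity and existence of a minimizer\<close>

lemma half_norm_power2_ge_affine:
  fixes y z h :: "'y::real_inner"
  shows "(y - z) \<bullet> h - 1/2 * (norm h)\<^sup>2 \<le> 1/2 * (norm (y - z))\<^sup>2"
proof -
  have "0 \<le> (norm ((y - z) - h))\<^sup>2" by simp
  then show ?thesis by (simp add: power2_norm_eq_inner inner_diff_left inner_diff_right inner_commute)
qed

text \<open>It suffices to use one affine minorant of \<open>\<parallel>y - z\<parallel>\<^sup>2 / 2\<close>, namely the one that touches it at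
  the weak limit. With it, each term of the supremum that defines the conjugate gives a convergent
  lower bound for the objective.\<close>

lemma half_norm_plus_conjugate_weakly_lsc:
  fixes y :: "nat \<Rightarrow> 'y::real_inner"
  assumes y: "weak_lim y y0" and f: "L2_weak_lim \<Omega> f u"
    and lim: "(\<lambda>n. ereal (1/2 * (norm (y n - z))\<^sup>2) + L2_conjugate \<Omega> H (f n)) \<longlonglongrightarrow> m"
  shows "ereal (1/2 * (norm (y0 - z))\<^sup>2) + L2_conjugate \<Omega> H u \<le> m"
proof -
  define h where "h = y0 - z"
  define A where "A v = (v - z) \<bullet> h - 1/2 * (norm h)\<^sup>2" for v
  have A0: "A y0 = 1/2 * (norm (y0 - z))\<^sup>2"
    by (simp add: A_def h_def power2_norm_eq_inner)
  have "ereal (L2_inner \<Omega> u q) - H q \<le> m - ereal (A y0)" if q: "q \<in> L2 \<Omega>" for q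
  proof -
    have inner_lim: "(\<lambda>n. L2_inner \<Omega> (f n) q) \<longlonglongrightarrow> L2_inner \<Omega> u q"
      using f q by (simp add: L2_weak_lim_def)
    have "(\<lambda>n. A (y n)) \<longlonglongrightarrow> A y0"
      unfolding A_def inner_diff_left using y unfolding weak_lim_def
      by (intro tendsto_diff tendsto_const) simp
    then have "(\<lambda>n. ereal (A (y n)) + (ereal (L2_inner \<Omega> (f n) q) - H q))
        \<longlonglongrightarrow> ereal (A y0) + (ereal (L2_inner \<Omega> u q) - H q)"
      using inner_lim by (intro tendsto_add_ereal_general2 tendsto_diff_ereal_general tendsto_ereal) auto
    moreover have "ereal (A (y n)) + (ereal (L2_inner \<Omega> (f n) q) - H q)
        \<le> ereal (1/2 * (norm (y n - z))\<^sup>2) + L2_conjugate \<Omega> H (f n)" for n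
      unfolding L2_conjugate_def
      by (intro add_mono SUP_upper q) (use half_norm_power2_ge_affine[of "y n" z h] in \<open>simp add: A_def\<close>)
    ultimately have "ereal (A y0) + (ereal (L2_inner \<Omega> u q) - H q) \<le> m"
      using lim by (blast intro: LIMSEQ_le)
    then show ?thesis by (simp add: ereal_le_minus add.commute)
  qed
  then have "L2_conjugate \<Omega> H u \<le> m - ereal (A y0)"
    unfolding L2_conjugate_def by (rule SUP_least)
  then show ?thesis by (simp add: A0 ereal_le_minus add.commute)
qed

theorem proposition2p1:
  fixes \<Omega> :: "(real ^ 'n) set"
    and d :: nat and v :: "nat \<Rightarrow> real"
    and S :: "(real ^ 'n \<Rightarrow> real) \<Rightarrow> 'y :: {real_inner, complete_space}"
    and z :: 'y and \<alpha> \<beta> :: real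
  assumes "open \<Omega>" and "connected \<Omega>" and "\<Omega> \<noteq> {}" and "bounded \<Omega>"
    and "d \<ge> 2" and "strict_mono_on {1..d} v"
    and "weak_to_weak_continuous \<Omega> (admissible \<Omega> d v) S"
    and "twice_frechet_differentiable \<Omega> (admissible \<Omega> d v) S"
    and "\<alpha> > 0" and "\<beta> \<ge> 0"
  shows "\<exists>ubar \<in> admissible \<Omega> d v. \<forall>u \<in> admissible \<Omega> d v.
           ereal (1 / 2 * (norm (S ubar - z))\<^sup>2) + G \<Omega> d v \<alpha> \<beta> ubar
             \<le> ereal (1 / 2 * (norm (S u - z))\<^sup>2) + G \<Omega> d v \<alpha> \<beta> u"
proof -
  let ?U = "admissible \<Omega> d v"
  define J where "J u = ereal (1 / 2 * (norm (S u - z))\<^sup>2) + G \<Omega> d v \<alpha> \<beta> u" for u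
  have U: "?U = L2_between \<Omega> (v 1) (v d)" by (simp add: admissible_def L2_between_def)
  have \<Omega>: "\<Omega> \<in> lmeasurable" using \<open>open \<Omega>\<close> \<open>bounded \<Omega>\<close> by (rule lmeasurable_open[rotated])
  have "v 1 \<le> v d" using \<open>strict_mono_on {1..d} v\<close> \<open>d \<ge> 2\<close> by (auto intro: strict_mono_on_leD)
  then have "(\<lambda>_. v 1) \<in> ?U" unfolding U by (intro L2_betweenI[OF \<Omega>]) simp_all
  then obtain J_n where J_n: "\<forall>n. J_n n \<in> J ` ?U" and min_lim: "J_n \<longlonglongrightarrow> Inf (J ` ?U)"
    using Inf_as_limit[of "J ` ?U"] by blast
  from J_n have "\<forall>n. \<exists>u. u \<in> ?U \<and> J_n n = J u" by blast
  then obtain f where f: "\<And>n. f n \<in> ?U" and J_f: "\<And>n. J_n n = J (f n)"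
    unfolding choice_iff by blast
  obtain ubar r where ubar: "ubar \<in> ?U" and r: "strict_mono r"
    and weak: "L2_weak_lim \<Omega> (\<lambda>n. f (r n)) ubar"
    using L2_between_weakly_sequentially_compact[OF \<Omega>, of f "v 1" "v d"] f unfolding U by blast
  have "weak_lim (\<lambda>n. S (f (r n))) (S ubar)"
    using \<open>weak_to_weak_continuous \<Omega> ?U S\<close> f ubar weak unfolding weak_to_weak_continuous_def by simp
  moreover have "(\<lambda>n. J (f (r n))) \<longlonglongrightarrow> Inf (J ` ?U)"
    using LIMSEQ_subseq_LIMSEQ[OF min_lim r] by (simp add: J_f o_def)
  ultimately have "J ubar \<le> Inf (J ` ?U)"
    unfolding J_def G_def by (rule half_norm_plus_conjugate_weakly_lsc[OF _ weak])
  then have "J ubar \<le> J u" if "u \<in> ?U" for u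
    using that by (meson INF_lower order_trans)
  then show ?thesis using ubar unfolding J_def by blast
qed

end
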